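(* Let $m\ge 1$, let $\mathcal{G}=([m],E)$ be an undirected graph, and let $G=\{g\in \mathrm{GL}_m(\mathbb{R}) \mid g\cdot \mathcal{S}^+_{\mathcal{G}}\subseteq \mathcal{S}^+_{\mathcal{G}}\}$. Then $G$ is generated by the group $G^0=\{g\in \mathrm{GL}_m(\mathbb{R}) \mid g_{ij}=0 \text{ for all } i,j \text{ with } j\not\preccurlyeq i\}$ together with the permutation matrices corresponding to the automorphisms of the graph $\mathcal{G}$.
   Context: Graphs are finite and simple, $[m]=\{1,\dots,m\}$, and $E$ is a set of two-element subsets of $[m]$. $\mathcal{S}_{\mathcal{G}}$ is the linear space of real symmetric $m\times m$ matrices whose $(i,j)$ entry is zero whenever $i\ne j$ and $\{i,j\}\notin E$; $\mathcal{S}^+_{\mathcal{G}}$ is the set of positive definite matrices in $\mathcal{S}_{\mathcal{G}}$. The group $\mathrm{GL}_m(\mathbb{R})$ acts on real symmetric $m\times m$ matrices by $g\cdot K=g^{-T}Kg^{-1}$. Writing $N(i)=\{j\in[m] : \{i,j\}\in E\}$, the pre-order $\preccurlyeq$ on $[m]$ is defined by $i\preccurlyeq j$ if and only if $N(j)\cup\{j\}\subseteq N(i)\cup\{i\}$. The set $G^0$ is a subgroup of $\mathrm{GL}_m(\mathbb{R})$. The permutation matrix corresponding to a graph automorphism $\pi$ of $\mathcal{G}$ has ones at the positions $(i,\pi(i))$, $i\in[m]$, and zeros elsewhere. *)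

theory Defs
  imports "HOL-Analysis.Analysis" "HOL-Algebra.Generated_Groups"
begin

text \<open>
  The vertex set \<open>[m]\<close> is the universe of a finite type \<open>'m\<close> with \<open>m = CARD('m)\<close>
  (so \<open>m \<ge> 1\<close>), and a graph is given by its edge set.
\<close>

definition simple_graph :: "'m::finite set set \<Rightarrow> bool" where
  "simple_graph E \<longleftrightarrow> (\<forall>e\<in>E. card e = 2)"

definition nbrs :: "'m::finite set set \<Rightarrow> 'm \<Rightarrow> 'm set" where
  "nbrs E i = {j. {i, j} \<in> E}"

definition vertex_le :: "'m::finite set set \<Rightarrow> 'm \<Rightarrow> 'm \<Rightarrow> bool" where
  "vertex_le E i j \<longleftrightarrow> nbrs E j \<union> {j} \<subseteq> nbrs E i \<union> {i}"

definition graph_aut :: "'m::finite set set \<Rightarrow> ('m \<Rightarrow> 'm) \<Rightarrow> bool" where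
  "graph_aut E \<pi> \<longleftrightarrow> bij \<pi> \<and> (\<forall>i j. {\<pi> i, \<pi> j} \<in> E \<longleftrightarrow> {i, j} \<in> E)"

definition perm_matrix :: "('m::finite \<Rightarrow> 'm) \<Rightarrow> real^'m^'m" where
  "perm_matrix \<pi> = (\<chi> i j. if j = \<pi> i then 1 else 0)"

definition pos_definite :: "real^'m^'m \<Rightarrow> bool" where
  "pos_definite K \<longleftrightarrow> transpose K = K \<and> (\<forall>x. x \<noteq> 0 \<longrightarrow> 0 < x \<bullet> (K *v x))"

definition S_graph :: "'m::finite set set \<Rightarrow> (real^'m^'m) set" where
  "S_graph E =
     {K. transpose K = K \<and> (\<forall>i j. i \<noteq> j \<and> {i, j} \<notin> E \<longrightarrow> K $ i $ j = 0)}"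

definition S_graph_pos :: "'m::finite set set \<Rightarrow> (real^'m^'m) set" where
  "S_graph_pos E = {K \<in> S_graph E. pos_definite K}"

definition GL :: "(real^'m^'m) monoid" where
  "GL = \<lparr>carrier = {g. invertible g}, mult = (**), one = mat 1\<rparr>"

definition act :: "real^'m^'m \<Rightarrow> real^'m^'m \<Rightarrow> real^'m^'m" where
  "act g K = transpose (matrix_inv g) ** K ** matrix_inv g"

definition G_stab :: "'m::finite set set \<Rightarrow> (real^'m^'m) set" where
  "G_stab E = {g \<in> carrier GL. act g ` S_graph_pos E \<subseteq> S_graph_pos E}"

definition G_zero :: "'m::finite set set \<Rightarrow> (real^'m^'m) set" where
  "G_zero E = {g \<in> carrier GL. \<forall>i j. \<not> vertex_le E j i \<longrightarrow> g $ i $ j = 0}"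

text \<open>
  \<^const>\<open>GL\<close> is a group whose inverse is \<^const>\<open>matrix_inv\<close>, so that
  \<^term>\<open>generate GL H\<close> is the subgroup of invertible matrices generated by \<open>H\<close>.
\<close>

lemma group_GL: "group (GL :: (real^'m^'m) monoid)"
proof (rule groupI)
  fix x :: "real^'m^'m"
  assume "x \<in> carrier GL"
  then obtain y where "x ** y = mat 1" "y ** x = mat 1"
    by (auto simp: GL_def invertible_def)
  then show "\<exists>y\<in>carrier GL. y \<otimes>\<^bsub>GL\<^esub> x = \<one>\<^bsub>GL\<^esub>"
    by (auto simp: GL_def invertible_def)
next
  show "\<one>\<^bsub>GL\<^esub> \<in> carrier (GL :: (real^'m^'m) monoid)"
    by (auto simp: GL_def invertible_def intro: exI[of _ "mat 1"])
qed (auto simp: GL_def invertible_mult matrix_mul_assoc)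

lemma inv_GL:
  fixes g :: "real^'m^'m"
  assumes "g \<in> carrier GL"
  shows "inv\<^bsub>GL\<^esub> g = matrix_inv g"
proof -
  have "\<exists>h. g ** h = mat 1 \<and> h ** g = mat 1"
    using assms by (simp add: GL_def invertible_def)
  then have h: "g ** matrix_inv g = mat 1 \<and> matrix_inv g ** g = mat 1"
    unfolding matrix_inv_def by (rule someI_ex)
  then have "matrix_inv g \<in> carrier GL"
    by (auto simp: GL_def invertible_def)
  with h assms show ?thesis
    using group.inv_equality[OF group_GL, of "matrix_inv g" g] by (simp add: GL_def)
qed

end

theory Submission
  imports Defs
begin

text \<open>
  Put \<open>h = g\<inverse>\<close>, so that \<open>g\<close> acts by the congruence \<open>K \<mapsto> h\<^sup>T K h\<close>.  If a vector \<open>v\<close> has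
  a clique as support, then both \<open>I\<close> and \<open>I + v v\<^sup>T\<close> are positive definite matrices of the graph,
  and the difference of their images is \<open>w w\<^sup>T\<close> with \<open>w = h\<^sup>T v\<close>.  An element \<open>g\<close> of the
  stabiliser therefore makes \<open>h\<^sup>T\<close> map clique-supported vectors to clique-supported vectors
  (\<open>stab_maps_clique_supported\<close>).  Taking for \<open>v\<close> a unit vector, or the sum of the unit
  vectors at the ends of an edge, shows that the supports \<open>C i\<close> of the rows of \<open>h\<close> behave as
  follows: if \<open>i\<close> and \<open>j\<close> are equal or adjacent, every vertex of \<open>C i\<close> is equal or adjacent to
  every vertex of \<open>C j\<close> (\<open>stab_row_supports\<close>).

  As \<open>det h \<noteq> 0\<close>, some term of the Leibniz expansion is non-zero, which yields a permutation
  \<open>\<pi>\<close> with \<open>\<pi> i \<in> C i\<close> for all \<open>i\<close>.  The property of the supports makes \<open>\<pi>\<close> an adjacency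
  preserving bijection, and so an automorphism, the edge set being finite.  Moreover it gives
  that \<open>\<pi> j \<in> C i\<close> implies \<open>j \<preccurlyeq> i\<close>: for \<open>l\<close> in the closed neighbourhood of \<open>i\<close> the vertices
  \<open>\<pi> j \<in> C i\<close> and \<open>\<pi> l \<in> C l\<close> are equal or adjacent, whence so are \<open>j\<close> and \<open>l\<close>.  This says exactly
  that \<open>h\<close> with its columns permuted by \<open>\<pi>\<close> lies in \<open>G\<^sup>0\<close>, so \<open>h\<close>, and with it \<open>g\<close>, is a
  product of the proposed generators.

  Conversely, the congruence by an element of \<open>G\<^sup>0\<close> or by a permutation matrix of an automorphism
  keeps the zero pattern of the graph, by inspection of the entries.  The one point that needs an
  argument is that \<open>G\<^sup>0\<close> is closed under inverses (\<open>G_zero_inverse\<close>), since \<open>g\<close> acts through \<open>g\<inverse>\<close>.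
\<close>

section \<open>Closed adjacency\<close>

definition adj_eq :: "'m::finite set set \<Rightarrow> 'm \<Rightarrow> 'm \<Rightarrow> bool" where
  "adj_eq E i j \<longleftrightarrow> i = j \<or> {i, j} \<in> E"

lemma adj_eq_refl [simp]: "adj_eq E i i"
  by (simp add: adj_eq_def)

lemma adj_eq_sym: "adj_eq E i j \<Longrightarrow> adj_eq E j i"
  by (auto simp: adj_eq_def insert_commute)

lemma vertex_le_iff: "vertex_le E i j \<longleftrightarrow> (\<forall>l. adj_eq E j l \<longrightarrow> adj_eq E i l)"
  by (auto simp: vertex_le_def nbrs_def adj_eq_def)

lemma vertex_le_refl: "vertex_le E i i"
  by (simp add: vertex_le_iff)

lemma vertex_le_trans: "vertex_le E i j \<Longrightarrow> vertex_le E j k \<Longrightarrow> vertex_le E i k"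
  by (simp add: vertex_le_iff)

lemma S_graph_iff:
  "K \<in> S_graph E \<longleftrightarrow> transpose K = K \<and> (\<forall>i j. K $ i $ j \<noteq> 0 \<longrightarrow> adj_eq E i j)"
  by (auto simp: S_graph_def adj_eq_def)

lemma graph_aut_adj_eq:
  assumes "graph_aut E \<pi>"
  shows "adj_eq E (\<pi> i) (\<pi> j) \<longleftrightarrow> adj_eq E i j"
  using assms by (auto simp: graph_aut_def adj_eq_def bij_def inj_def)

lemma graph_aut_inv:
  assumes "graph_aut E \<pi>"
  shows "graph_aut E (inv_into UNIV \<pi>)"
proof -
  have b: "bij \<pi>" and e: "\<And>i j. {\<pi> i, \<pi> j} \<in> E \<longleftrightarrow> {i, j} \<in> E"
    using assms by (auto simp: graph_aut_def)
  have "\<pi> (inv_into UNIV \<pi> i) = i" for i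
    using b by (simp add: bij_is_surj surj_f_inv_f)
  then have "{inv_into UNIV \<pi> i, inv_into UNIV \<pi> j} \<in> E \<longleftrightarrow> {i, j} \<in> E" for i j
    using e[of "inv_into UNIV \<pi> i" "inv_into UNIV \<pi> j"] by simp
  then show ?thesis
    using b by (simp add: graph_aut_def bij_imp_bij_inv)
qed

text \<open>
  A bijective homomorphism of a finite graph is an automorphism: the map that it induces on the
  finite edge set is injective and hence onto, so that non-edges cannot become edges.  Loops have
  to be excluded because closed adjacency does not see them.
\<close>

lemma bij_preserving_adj_eq_graph_aut:
  assumes E: "simple_graph E" and b: "bij \<pi>"
    and hom: "\<And>i j. adj_eq E i j \<Longrightarrow> adj_eq E (\<pi> i) (\<pi> j)"
  shows "graph_aut E \<pi>"
proof -
  have inj: "inj \<pi>" using b by (simp add: bij_is_inj)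
  have edge: "{\<pi> i, \<pi> j} \<in> E" if "{i, j} \<in> E" for i j
  proof -
    have "i \<noteq> j"
    proof
      assume "i = j"
      with that have "{i} \<in> E" by simp
      with E have "card {i} = 2" unfolding simple_graph_def by blast
      then show False by simp
    qed
    then have "\<pi> i \<noteq> \<pi> j" using inj by (simp add: inj_eq)
    then show ?thesis using hom[of i j] that by (simp add: adj_eq_def)
  qed
  have sub: "image \<pi> ` E \<subseteq> E"
  proof
    fix e' assume "e' \<in> image \<pi> ` E"
    then obtain e where e: "e \<in> E" "e' = \<pi> ` e" by blast
    then have "card e = 2" using E by (simp add: simple_graph_def)
    then obtain i j where "e = {i, j}" by (auto simp: card_2_iff)
    then show "e' \<in> E" using e edge by simp
  qed
  have "inj_on (image \<pi>) E"
    using inj by (auto simp: inj_on_def inj_image_eq_iff)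
  then have surj: "image \<pi> ` E = E"
    using sub by (simp add: endo_inj_surj)
  have "{i, j} \<in> E" if ij: "{\<pi> i, \<pi> j} \<in> E" for i j
  proof -
    have "{\<pi> i, \<pi> j} \<in> image \<pi> ` E" using ij by (simp only: surj)
    then obtain e where e: "e \<in> E" "\<pi> ` e = {\<pi> i, \<pi> j}"
      by (metis imageE)
    then have "\<pi> ` e = \<pi> ` {i, j}" by simp
    then have "e = {i, j}" by (rule inj_image_eq_iff[OF inj, THEN iffD1])
    with e(1) show ?thesis by simp
  qed
  with edge b show ?thesis unfolding graph_aut_def by blast
qed

section \<open>Congruence of positive definite matrices\<close>

lemma carrier_GL [simp]: "g \<in> carrier GL \<longleftrightarrow> invertible g"
  by (simp add: GL_def)

lemma mult_GL [simp]: "x \<otimes>\<^bsub>GL\<^esub> y = x ** y"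
  by (simp add: GL_def)

lemma one_GL [simp]: "\<one>\<^bsub>GL\<^esub> = mat 1"
  by (simp add: GL_def)

lemma invertible_imp_matrix_inv:
  fixes g :: "real^'m^'m"
  assumes "invertible g"
  shows "g ** matrix_inv g = mat 1" "matrix_inv g ** g = mat 1" "invertible (matrix_inv g)"
    "matrix_inv (matrix_inv g) = g"
proof -
  have g: "g \<in> carrier GL" using assms by simp
  show "g ** matrix_inv g = mat 1" "matrix_inv g ** g = mat 1"
    using group.r_inv[OF group_GL g] group.l_inv[OF group_GL g] inv_GL[OF g] by simp_all
  have i: "matrix_inv g \<in> carrier GL"
    using group.inv_closed[OF group_GL g] inv_GL[OF g] by simp
  then show "invertible (matrix_inv g)" by simp
  show "matrix_inv (matrix_inv g) = g"
    using group.inv_inv[OF group_GL g] inv_GL[OF g] inv_GL[OF i] by simp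
qed

lemma matrix_inv_unique_right:
  fixes g :: "real^'m^'m"
  assumes "g ** h = mat 1"
  shows "matrix_inv g = h"
proof -
  have "invertible g" using assms by (auto simp: invertible_right_inverse)
  then have "matrix_inv g ** (g ** h) = h"
    by (simp add: matrix_mul_assoc invertible_imp_matrix_inv)
  then show ?thesis by (simp add: assms)
qed

lemma act_mult:
  fixes g h K :: "real^'m^'m"
  assumes "invertible g" "invertible h"
  shows "act (g ** h) K = act g (act h K)"
proof -
  have "matrix_inv (g ** h) = matrix_inv h ** matrix_inv g"
  proof (rule matrix_inv_unique_right)
    have "(g ** h) ** (matrix_inv h ** matrix_inv g)
        = g ** (h ** matrix_inv h) ** matrix_inv g"
      by (simp only: matrix_mul_assoc)
    then show "(g ** h) ** (matrix_inv h ** matrix_inv g) = mat 1"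
      using assms by (simp add: invertible_imp_matrix_inv)
  qed
  then show ?thesis by (simp add: act_def matrix_transpose_mul matrix_mul_assoc)
qed

lemma pos_definite_congruence:
  fixes h K :: "real^'m^'m"
  assumes K: "pos_definite K" and h: "invertible h"
  shows "pos_definite (transpose h ** K ** h)"
proof -
  have "0 < x \<bullet> ((transpose h ** K ** h) *v x)" if "x \<noteq> 0" for x
  proof -
    have "h *v x \<noteq> 0"
    proof
      assume "h *v x = 0"
      then have "matrix_inv h *v (h *v x) = 0" by simp
      then show False
        using that h by (simp add: matrix_vector_mul_assoc invertible_imp_matrix_inv)
    qed
    then have "0 < (h *v x) \<bullet> (K *v (h *v x))"
      using K by (simp add: pos_definite_def)
    also have "\<dots> = x \<bullet> (transpose h *v (K *v (h *v x)))"
      by (metis dot_lmul_matrix transpose_matrix_vector transpose_transpose)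
    finally show ?thesis
      by (simp only: matrix_vector_mul_assoc matrix_mul_assoc)
  qed
  moreover have "transpose (transpose h ** K ** h) = transpose h ** K ** h"
    using K by (simp add: pos_definite_def matrix_transpose_mul matrix_mul_assoc)
  ultimately show ?thesis by (simp add: pos_definite_def)
qed

lemma congruence_entry:
  fixes h K :: "real^'m^'m"
  shows "(transpose h ** K ** h) $ i $ j = (\<Sum>l\<in>UNIV. \<Sum>k\<in>UNIV. h $ k $ i * K $ k $ l * h $ l $ j)"
  by (simp add: matrix_matrix_mult_def transpose_def sum_distrib_right)

text \<open>
  A non-zero entry of \<open>h\<^sup>T K h\<close> needs a non-zero summand \<open>h k i * K k l * h l j\<close>.  Thus
  membership in the cone can be read off the zero pattern of \<open>h\<close>, and the same argument serves
  for \<open>G\<^sup>0\<close> and for the permutation matrices.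
\<close>

lemma congruence_S_graph_pos:
  fixes h :: "real^'m::finite^'m"
  assumes h: "invertible h"
    and pattern: "\<And>i j k l. h $ k $ i \<noteq> 0 \<Longrightarrow> adj_eq E k l \<Longrightarrow> h $ l $ j \<noteq> 0 \<Longrightarrow> adj_eq E i j"
    and K: "K \<in> S_graph_pos E"
  shows "transpose h ** K ** h \<in> S_graph_pos E"
proof -
  have pd: "pos_definite (transpose h ** K ** h)"
    using K h by (simp add: S_graph_pos_def pos_definite_congruence)
  have "adj_eq E i j" if "(transpose h ** K ** h) $ i $ j \<noteq> 0" for i j
  proof -
    have "(\<Sum>l\<in>UNIV. \<Sum>k\<in>UNIV. h $ k $ i * K $ k $ l * h $ l $ j) \<noteq> 0"
      using that by (simp add: congruence_entry)
    then obtain l where "(\<Sum>k\<in>UNIV. h $ k $ i * K $ k $ l * h $ l $ j) \<noteq> 0"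
      by (rule sum.not_neutral_contains_not_neutral)
    then obtain k where "h $ k $ i * K $ k $ l * h $ l $ j \<noteq> 0"
      by (rule sum.not_neutral_contains_not_neutral)
    then have "h $ k $ i \<noteq> 0" "K $ k $ l \<noteq> 0" "h $ l $ j \<noteq> 0" by auto
    moreover have "adj_eq E k l"
      using K \<open>K $ k $ l \<noteq> 0\<close> by (simp add: S_graph_pos_def S_graph_iff)
    ultimately show ?thesis using pattern by blast
  qed
  with pd show ?thesis
    by (auto simp: S_graph_pos_def S_graph_iff pos_definite_def)
qed

section \<open>The generators stabilise the cone\<close>

lemma G_zero_iff:
  "g \<in> G_zero E \<longleftrightarrow> invertible g \<and> (\<forall>i j. g $ i $ j \<noteq> 0 \<longrightarrow> vertex_le E j i)"
  by (auto simp: G_zero_def)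

text \<open>
  Transitivity of the pre-order makes the matrices with the zero pattern of \<open>G\<^sup>0\<close> a
  finite-dimensional algebra.  Left multiplication by \<open>g\<close> is an injective endomorphism of it,
  hence onto, and the preimage of the identity is the inverse of \<open>g\<close>.
\<close>

lemma G_zero_inverse:
  fixes E :: "'m::finite set set"
  assumes g: "g \<in> G_zero E"
  shows "matrix_inv g \<in> G_zero E"
proof -
  define A :: "(real^'m^'m) set" where
    "A = {M. \<forall>i j. \<not> vertex_le E j i \<longrightarrow> M $ i $ j = 0}"
  have inv: "invertible g" and gA: "g \<in> A"
    using g by (auto simp: G_zero_iff A_def)
  have sub: "subspace A"
    by (auto simp: subspace_def A_def)
  have lin: "linear (\<lambda>M. g ** M)"
    by (rule linearI) (simp_all add: matrix_add_ldistrib scaleR_vec_def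
        matrix_matrix_mult_def vec_eq_iff sum_distrib_left mult.left_commute
        distrib_left sum.distrib)
  have inj: "inj (\<lambda>M. g ** M)"
  proof (rule injI)
    fix M N assume "g ** M = g ** N"
    then have "matrix_inv g ** (g ** M) = matrix_inv g ** (g ** N)" by simp
    then show "M = N" using inv by (simp add: matrix_mul_assoc invertible_imp_matrix_inv)
  qed
  have closed: "g ** M \<in> A" if M: "M \<in> A" for M
    unfolding A_def
  proof (intro CollectI allI impI)
    fix i j assume n: "\<not> vertex_le E j i"
    have "g $ i $ k * M $ k $ j = 0" for k
      using n gA M vertex_le_trans[of E j k i] by (auto simp: A_def)
    then show "(g ** M) $ i $ j = 0"
      unfolding matrix_matrix_mult_def by (simp only: vec_lambda_beta sum.neutral_const)
  qed
  have "(\<lambda>M. g ** M) ` A = A"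
  proof (rule subspace_dim_equal)
    show "subspace ((\<lambda>M. g ** M) ` A)" using lin sub by (rule linear_subspace_image)
    show "dim A \<le> dim ((\<lambda>M. g ** M) ` A)"
      using dim_image_eq[OF lin inj_on_subset[OF inj subset_UNIV], of A] by simp
  qed (use sub closed in auto)
  moreover have "mat 1 \<in> A"
    using vertex_le_refl by (auto simp: A_def mat_def)
  ultimately obtain M where M: "M \<in> A" "g ** M = mat 1"
    by (metis (no_types, lifting) imageE)
  then have "matrix_inv g = M" by (simp add: matrix_inv_unique_right)
  with M inv show ?thesis
    by (auto simp: G_zero_def A_def invertible_imp_matrix_inv)
qed

lemma G_zero_subset_G_stab: "G_zero E \<subseteq> G_stab E"
proof
  fix g assume g: "g \<in> G_zero E"
  have inv: "matrix_inv g \<in> G_zero E" using g by (rule G_zero_inverse)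
  have "act g K \<in> S_graph_pos E" if "K \<in> S_graph_pos E" for K
    unfolding act_def
  proof (rule congruence_S_graph_pos)
    fix i j k l
    assume "matrix_inv g $ k $ i \<noteq> 0" "adj_eq E k l" "matrix_inv g $ l $ j \<noteq> 0"
    then have "vertex_le E i k" "adj_eq E k l" "vertex_le E j l"
      using inv by (auto simp: G_zero_iff)
    then show "adj_eq E i j" by (meson adj_eq_sym vertex_le_iff)
  qed (use inv that in \<open>auto simp: G_zero_iff\<close>)
  with g show "g \<in> G_stab E" by (auto simp: G_stab_def G_zero_iff)
qed

lemma mult_perm_matrix_entry:
  fixes A :: "real^'m::finite^'m"
  assumes "bij \<pi>"
  shows "(A ** perm_matrix \<pi>) $ i $ j = A $ i $ (inv_into UNIV \<pi> j)"
proof -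
  have "j = \<pi> k \<longleftrightarrow> k = inv_into UNIV \<pi> j" for k
    using assms by (metis bij_inv_eq_iff)
  then show ?thesis
    by (simp add: matrix_matrix_mult_def perm_matrix_def if_distrib cong: if_cong)
qed

lemma perm_matrix_mult_inv:
  fixes \<pi> :: "'m::finite \<Rightarrow> 'm"
  assumes "bij \<pi>"
  shows "perm_matrix \<pi> ** perm_matrix (inv_into UNIV \<pi>) = (mat 1 :: real^'m^'m)"
proof -
  have "\<pi> i = \<pi> j \<longleftrightarrow> i = j" for i j using assms by (simp add: bij_is_inj inj_eq)
  then show ?thesis
    using assms by (simp add: vec_eq_iff mult_perm_matrix_entry bij_imp_bij_inv inv_inv_eq)
      (auto simp: perm_matrix_def mat_def)
qed

lemma perm_matrix_invertible:
  "bij \<pi> \<Longrightarrow> invertible (perm_matrix \<pi> :: real^'m::finite^'m)"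
  using perm_matrix_mult_inv invertible_right_inverse by blast

lemma matrix_inv_perm_matrix:
  "bij \<pi> \<Longrightarrow> matrix_inv (perm_matrix \<pi> :: real^'m::finite^'m) = perm_matrix (inv_into UNIV \<pi>)"
  by (simp add: perm_matrix_mult_inv matrix_inv_unique_right)

lemma perm_matrix_in_G_stab:
  assumes a: "graph_aut E \<pi>"
  shows "perm_matrix \<pi> \<in> G_stab E"
proof -
  have b: "bij \<pi>" using a by (simp add: graph_aut_def)
  have "act (perm_matrix \<pi>) K \<in> S_graph_pos E" if "K \<in> S_graph_pos E" for K
    unfolding act_def matrix_inv_perm_matrix[OF b]
  proof (rule congruence_S_graph_pos)
    show "invertible (perm_matrix (inv_into UNIV \<pi>) :: real^_^_)"
      using b by (simp add: perm_matrix_invertible bij_imp_bij_inv)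
    fix i j k l
    assume "(perm_matrix (inv_into UNIV \<pi>) :: real^_^_) $ k $ i \<noteq> 0" "adj_eq E k l"
      "(perm_matrix (inv_into UNIV \<pi>) :: real^_^_) $ l $ j \<noteq> 0"
    then show "adj_eq E i j"
      using graph_aut_adj_eq[OF graph_aut_inv[OF a]]
      by (auto simp: perm_matrix_def split: if_splits)
  qed (rule that)
  then show ?thesis using b by (auto simp: G_stab_def perm_matrix_invertible)
qed

lemma G_stab_one:
  fixes E :: "'m::finite set set"
  shows "mat 1 \<in> G_stab E"
proof -
  have "invertible (mat 1 :: real^'m^'m)" by (auto simp: invertible_right_inverse)
  then have "mat 1 \<in> G_zero E" using vertex_le_refl by (auto simp: G_zero_iff mat_def)
  then show ?thesis using G_zero_subset_G_stab by blast
qed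

lemma G_stab_mult:
  assumes "g \<in> G_stab E" "h \<in> G_stab E"
  shows "g ** h \<in> G_stab E"
  using assms by (auto simp: G_stab_def act_mult invertible_mult)

text \<open>
  The definition of the stabiliser by an inclusion gives only a monoid at once.  It contains the
  generated group because the set of generators is closed under inverses.
\<close>

lemma generate_subset_G_stab:
  fixes E :: "'m::finite set set"
  shows "generate GL (G_zero E \<union> {perm_matrix \<pi> | \<pi>. graph_aut E \<pi>}) \<subseteq> G_stab E"
proof
  let ?H = "G_zero E \<union> {perm_matrix \<pi> | \<pi>. graph_aut E \<pi>} :: (real^'m^'m) set"
  have gen: "?H \<subseteq> G_stab E"
    using G_zero_subset_G_stab perm_matrix_in_G_stab by blast
  have inverse: "matrix_inv g \<in> ?H" if "g \<in> ?H" for g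
  proof -
    have "matrix_inv (perm_matrix \<pi>) \<in> ?H" if "graph_aut E \<pi>" for \<pi>
    proof -
      have "bij \<pi>" using that by (simp add: graph_aut_def)
      then show ?thesis using graph_aut_inv[OF that] matrix_inv_perm_matrix by auto
    qed
    then show ?thesis using that G_zero_inverse by auto
  qed
  fix g :: "real^'m^'m"
  assume "g \<in> generate GL ?H"
  then show "g \<in> G_stab E"
  proof (induction rule: generate.induct)
    case one
    then show ?case by (simp add: G_stab_one)
  next
    case (incl h)
    then show ?case using gen by blast
  next
    case (inv h)
    then have "h \<in> carrier GL" using gen by (auto simp: G_stab_def)
    then have "inv\<^bsub>GL\<^esub> h = matrix_inv h" by (rule inv_GL)
    then show ?case using inverse[OF inv] gen by auto
  next
    case (eng g h)
    then show ?case by (simp add: G_stab_mult)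
  qed
qed

section \<open>Supports of rows of an inverse\<close>

definition clique_supported :: "'m::finite set set \<Rightarrow> real^'m \<Rightarrow> bool" where
  "clique_supported E v \<longleftrightarrow> (\<forall>a b. v $ a \<noteq> 0 \<longrightarrow> v $ b \<noteq> 0 \<longrightarrow> adj_eq E a b)"

definition rank_one :: "real^'m \<Rightarrow> real^'m^'m" where
  "rank_one v = (\<chi> i j. v $ i * v $ j)"

lemma congruence_rank_one:
  fixes h :: "real^'m^'m"
  shows "transpose h ** rank_one v ** h = rank_one (transpose h *v v)"
proof -
  have "(transpose h ** rank_one v ** h) $ i $ j = rank_one (transpose h *v v) $ i $ j" for i j
  proof -
    have "(transpose h ** rank_one v ** h) $ i $ j
        = (\<Sum>l\<in>UNIV. \<Sum>k\<in>UNIV. (h $ l $ j * v $ l) * (h $ k $ i * v $ k))"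
      by (simp add: congruence_entry rank_one_def mult_ac)
    also have "\<dots> = (\<Sum>l\<in>UNIV. h $ l $ j * v $ l) * (\<Sum>k\<in>UNIV. h $ k $ i * v $ k)"
      by (simp add: sum_product)
    also have "\<dots> = rank_one (transpose h *v v) $ i $ j"
      by (simp add: rank_one_def matrix_vector_mult_def transpose_def mult_ac
          del: transpose_matrix_vector)
    finally show ?thesis .
  qed
  then show ?thesis by (simp add: vec_eq_iff)
qed

lemma id_plus_rank_one_in_S_graph_pos:
  fixes E :: "'m::finite set set"
  assumes "clique_supported E v"
  shows "mat 1 + rank_one v \<in> S_graph_pos E"
proof -
  have sym: "transpose (mat 1 + rank_one v) = mat 1 + rank_one v"
    by (simp add: vec_eq_iff transpose_def mat_def rank_one_def mult.commute)
  have "0 < x \<bullet> ((mat 1 + rank_one v) *v x)" if "x \<noteq> 0" for x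
  proof -
    have "rank_one v *v x = (v \<bullet> x) *\<^sub>R v"
      by (simp add: vec_eq_iff rank_one_def matrix_vector_mult_def inner_vec_def
          sum_distrib_left mult_ac)
    then have "x \<bullet> ((mat 1 + rank_one v) *v x) = x \<bullet> x + (v \<bullet> x)\<^sup>2"
      by (simp add: matrix_vector_mult_add_rdistrib inner_add_right power2_eq_square inner_commute)
    moreover have "0 < x \<bullet> x" using that by simp
    ultimately show ?thesis by (simp add: add_pos_nonneg)
  qed
  moreover have "adj_eq E i j" if "(mat 1 + rank_one v) $ i $ j \<noteq> 0" for i j
    using that assms by (cases "i = j") (auto simp: mat_def rank_one_def clique_supported_def)
  ultimately show ?thesis
    using sym by (auto simp: S_graph_pos_def S_graph_iff pos_definite_def)
qed

lemma matrix_mult_distrib_right: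
  fixes A B C :: "'a::semiring_1^'m^'m"
  shows "(A + B) ** C = A ** C + B ** C"
  by (simp add: vec_eq_iff matrix_matrix_mult_def distrib_right sum.distrib)

text \<open>
  The summand \<open>I\<close> moves \<open>v v\<^sup>T\<close> into the open cone; its image cancels when the images for \<open>v\<close>
  and for the zero vector are subtracted, which leaves \<open>w w\<^sup>T\<close> with \<open>w = h\<^sup>T v\<close>.
\<close>

lemma stab_maps_clique_supported:
  fixes E :: "'m::finite set set"
  assumes g: "g \<in> G_stab E" and v: "clique_supported E v"
  shows "clique_supported E (transpose (matrix_inv g) *v v)"
proof -
  let ?h = "matrix_inv g"
  let ?w = "transpose ?h *v v"
  have image: "transpose ?h ** K ** ?h \<in> S_graph E" if "K \<in> S_graph_pos E" for K
    using g that by (auto simp: G_stab_def S_graph_pos_def act_def)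
  have "transpose ?h ** (mat 1 + rank_one v) ** ?h
      = transpose ?h ** mat 1 ** ?h + rank_one ?w"
    unfolding congruence_rank_one[symmetric]
    by (simp add: matrix_add_ldistrib matrix_mult_distrib_right)
  then have sum: "transpose ?h ** mat 1 ** ?h + rank_one ?w \<in> S_graph E"
    using image[OF id_plus_rank_one_in_S_graph_pos[OF v]] by simp
  have "clique_supported E (0 :: real^'m)" "rank_one (0 :: real^'m) = 0"
    by (simp_all add: clique_supported_def rank_one_def vec_eq_iff)
  then have unit: "transpose ?h ** mat 1 ** ?h \<in> S_graph E"
    using image[OF id_plus_rank_one_in_S_graph_pos[of E 0]] by simp
  have "adj_eq E a b" if "?w $ a \<noteq> 0" "?w $ b \<noteq> 0" for a b
  proof -
    have "rank_one ?w $ a $ b \<noteq> 0" using that by (simp add: rank_one_def)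
    then have "(transpose ?h ** mat 1 ** ?h + rank_one ?w) $ a $ b \<noteq> 0
        \<or> (transpose ?h ** mat 1 ** ?h) $ a $ b \<noteq> 0" by auto
    then show ?thesis using sum unit unfolding S_graph_iff by blast
  qed
  then show ?thesis unfolding clique_supported_def by blast
qed

text \<open>
  The row \<open>i\<close> of \<open>h\<close> is the image under \<open>h\<^sup>T\<close> of a unit vector.  If \<open>a\<close> and \<open>b\<close> were distinct
  and non-adjacent, the row \<open>i\<close>, having a clique as support, would vanish at \<open>b\<close>, and likewise the
  row \<open>j\<close> at \<open>a\<close>.  The sum of the two rows would then be non-zero at both \<open>a\<close> and \<open>b\<close> although it
  is the image of a vector supported on the clique \<open>{i, j}\<close>.
\<close>

lemma stab_row_supports:
  fixes E :: "'m::finite set set"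
  assumes g: "g \<in> G_stab E" and ij: "adj_eq E i j"
    and a: "matrix_inv g $ i $ a \<noteq> 0" and b: "matrix_inv g $ j $ b \<noteq> 0"
  shows "adj_eq E a b"
proof (rule ccontr)
  assume n: "\<not> adj_eq E a b"
  let ?h = "matrix_inv g"
  have row: "transpose ?h *v axis k 1 = ?h $ k" for k
    by (simp add: vec_eq_iff matrix_vector_mult_def transpose_def axis_def if_distrib
        del: transpose_matrix_vector cong: if_cong)
  have single: "clique_supported E (?h $ k)" for k
  proof -
    have "clique_supported E (axis k 1)"
      by (simp add: clique_supported_def axis_def)
    from stab_maps_clique_supported[OF g this] show ?thesis by (simp only: row)
  qed
  have ji: "adj_eq E j i" using ij by (rule adj_eq_sym)
  have support: "x = i \<or> x = j" if "(axis i 1 + axis j 1 :: real^'m) $ x \<noteq> 0" for x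
    using that by (auto simp: axis_def split: if_splits)
  have "clique_supported E (axis i 1 + axis j 1)"
    unfolding clique_supported_def using support ij ji adj_eq_refl by metis
  from stab_maps_clique_supported[OF g this]
  have pair: "clique_supported E (?h $ i + ?h $ j)"
    unfolding matrix_vector_right_distrib row .
  have "?h $ i $ b = 0"
    using single[of i] a n unfolding clique_supported_def by metis
  moreover have "?h $ j $ a = 0"
    using single[of j] b n unfolding clique_supported_def by metis
  ultimately have "(?h $ i + ?h $ j) $ a \<noteq> 0" "(?h $ i + ?h $ j) $ b \<noteq> 0"
    using a b by simp_all
  then show False using pair n unfolding clique_supported_def by blast
qed

section \<open>Factorisation of the elements of the stabiliser\<close>

lemma invertible_imp_nonzero_transversal:
  fixes h :: "real^'m::finite^'m"
  assumes "invertible h"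
  obtains \<pi> where "bij \<pi>" "\<forall>i. h $ i $ \<pi> i \<noteq> 0"
proof -
  have "det h \<noteq> 0" using assms by (simp add: invertible_det_nz)
  then obtain p where "p \<in> {p. p permutes (UNIV :: 'm set)}"
    and nz: "of_int (sign p) * (\<Prod>i\<in>UNIV. h $ i $ p i) \<noteq> 0"
    unfolding det_def by (rule sum.not_neutral_contains_not_neutral)
  then have "bij p" by (simp add: permutes_bij)
  moreover have "\<forall>i. h $ i $ p i \<noteq> 0"
    using nz by auto
  ultimately show ?thesis by (rule that)
qed

text \<open>
  Permuting the columns of \<open>h = g\<inverse>\<close> along a transversal brings non-zero entries to the
  diagonal.  The supports of the rows then contain their own indices, and the relation between
  the supports of adjacent rows becomes the zero pattern of \<open>G\<^sup>0\<close>.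
\<close>

lemma G_stab_inverse_factorisation:
  fixes E :: "'m::finite set set"
  assumes E: "simple_graph E" and g: "g \<in> G_stab E"
  obtains h' \<pi> where "h' \<in> G_zero E" "graph_aut E \<pi>" "matrix_inv g = h' ** perm_matrix \<pi>"
proof -
  let ?h = "matrix_inv g"
  have hinv: "invertible ?h"
    using g by (simp add: G_stab_def invertible_imp_matrix_inv)
  then obtain \<pi> where b: "bij \<pi>" and nz: "\<forall>i. ?h $ i $ \<pi> i \<noteq> 0"
    by (rule invertible_imp_nonzero_transversal)
  have diag: "?h $ i $ \<pi> i \<noteq> 0" for i using nz by blast
  have aut: "graph_aut E \<pi>"
    using E b stab_row_supports[OF g _ diag diag] by (rule bij_preserving_adj_eq_graph_aut)
  define h' where "h' = ?h ** perm_matrix (inv_into UNIV \<pi>)"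
  have entry: "h' $ i $ j = ?h $ i $ \<pi> j" for i j
    using b by (simp add: h'_def mult_perm_matrix_entry bij_imp_bij_inv inv_inv_eq)
  have "invertible h'"
    using hinv b by (simp add: h'_def invertible_mult perm_matrix_invertible bij_imp_bij_inv)
  moreover have "vertex_le E j i" if "h' $ i $ j \<noteq> 0" for i j
    unfolding vertex_le_iff
  proof (intro allI impI)
    fix l assume "adj_eq E i l"
    then have "adj_eq E (\<pi> j) (\<pi> l)"
      using that diag by (auto simp: entry intro: stab_row_supports[OF g])
    then show "adj_eq E j l" by (simp add: graph_aut_adj_eq[OF aut])
  qed
  ultimately have "h' \<in> G_zero E" by (auto simp: G_zero_iff)
  moreover have "?h = h' ** perm_matrix \<pi>"
    using b by (simp add: vec_eq_iff mult_perm_matrix_entry entry bij_is_surj surj_f_inv_f)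
  ultimately show ?thesis using aut that by blast
qed

theorem theorem1p1:
  fixes E :: "'m::finite set set"
  assumes "simple_graph E"
  shows "G_stab E = generate GL (G_zero E \<union> {perm_matrix \<pi> | \<pi>. graph_aut E \<pi>})"
proof
  let ?H = "G_zero E \<union> {perm_matrix \<pi> | \<pi>. graph_aut E \<pi>} :: (real^'m^'m) set"
  show "generate GL ?H \<subseteq> G_stab E" by (rule generate_subset_G_stab)
  have carrier: "?H \<subseteq> carrier GL"
    by (auto simp: G_zero_iff graph_aut_def perm_matrix_invertible)
  show "G_stab E \<subseteq> generate GL ?H"
  proof
    fix g assume g: "g \<in> G_stab E"
    then obtain h' \<pi> where f: "h' \<in> G_zero E" "graph_aut E \<pi>"
      "matrix_inv g = h' ** perm_matrix \<pi>"
      using G_stab_inverse_factorisation[OF assms] by blast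
    have ginv: "invertible g" using g by (simp add: G_stab_def)
    have "h' \<in> generate GL ?H" "perm_matrix \<pi> \<in> generate GL ?H"
      using f by (auto intro: generate.incl)
    then have "h' \<otimes>\<^bsub>GL\<^esub> perm_matrix \<pi> \<in> generate GL ?H"
      by (rule generate.eng)
    then have "matrix_inv g \<in> generate GL ?H" by (simp add: f(3))
    then have "inv\<^bsub>GL\<^esub> (matrix_inv g) \<in> generate GL ?H"
      using group.generate_m_inv_closed[OF group_GL carrier] by blast
    then show "g \<in> generate GL ?H"
      using ginv by (simp add: inv_GL invertible_imp_matrix_inv)
  qed
qed

end
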